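(* Let $T:l_\infty\to l_\infty$ be a continuous positive linear map with adjoint $T^*$. If a binary relation $\succsim$ on $l_\infty$ satisfies Weak order, Monotonicity, Continuity, ICRP, Convexity and I$T$IS, then there exists a grounded and weak$^\star$-lower semicontinuous function $c:\Delta(T^* )\to[0,\infty]$ such that $$I(x)=\min_{p\in\Delta(T^* )}\{\langle x,p\rangle+c(p)\}$$ is a constant equivalent representing $\succsim$. Conversely, if $\succsim$ is represented by such an $I$ for some grounded weak$^\star$-lower semicontinuous $c:\Delta(T^* )\to[0,\infty]$, and $\langle 1,T^*(p)\rangle\le1$ for every $p\in\Delta(T^* )$, then $\succsim$ satisfies Weak order, Monotonicity, Continuity, ICRP, Convexity and I$T$IS.
   Context: $l_\infty$: real bounded sequences indexed by $\mathbb N$, sup norm; $\theta\in\mathbb R$ also denotes a constant sequence; $x\ge y$ coordinatewise. $ba(\mathbb N)$: norm dual of $l_\infty$ (bounded finitely additive signed measures on $2^{\mathbb N}$), pairing $\langle x,\mu\rangle$, weak$^\star$ topology. Adjoint: $\langle x,T^*(\mu)\rangle=\langle T(x),\mu\rangle$. $\Delta$: finitely additive probability measures on $2^{\mathbb N}$. Eigenvector of $T^*$: nonzero $\mu$ with $T^*(\mu)=\lambda\mu$ for some real $\lambda$; $\Delta(T^* )$ is the set of $p\in\Delta$ that are eigenvectors of $T^*$. Grounded: infimum $0$. A constant equivalent representing $\succsim$ is $I$ with $x\sim I(x)$ and $x\succsim y\iff I(x)\ge I(y)$. Weak order: complete, transitive. Monotonicity: $x\ge y\Rightarrow x\succsim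 y$, and $1\succ0$. Continuity: for $x\succsim y\succsim z$ the sets $\{\alpha\in[0,1]:\alpha x+(1-\alpha)z\succsim y\}$, $\{\alpha\in[0,1]:y\succsim\alpha x+(1-\alpha)z\}$ are closed. ICRP: $x\succsim y\Rightarrow x+\theta\succsim y+\theta$. Convexity: $x\succsim\theta,y\succsim\theta\Rightarrow\lambda x+(1-\lambda)y\succsim\theta$ for $\lambda\in[0,1]$. I$T$IS: for all $x,d\in l_\infty$, $x+d\succsim x$ implies $x+T(d)\succsim x$. *)

theory Defs
  imports "HOL-Analysis.Analysis"
begin

text \<open>l_infty: bounded real sequences with the sup norm, rendered as the
  type of bounded continuous functions from the discrete space nat to real.\<close>
type_synonym linf = "nat \<Rightarrow>\<^sub>C real"

text \<open>ba(N), the norm dual of l_infty: continuous linear functionals; pairing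
  <x,mu> = blinfun_apply mu x.\<close>
type_synonym ba = "linf \<Rightarrow>\<^sub>L real"

abbreviation cst :: "real \<Rightarrow> linf" where "cst \<theta> \<equiv> const_bcontfun \<theta>"

definition geq :: "linf \<Rightarrow> linf \<Rightarrow> bool" where
  "geq x y \<longleftrightarrow> (\<forall>n. apply_bcontfun x n \<ge> apply_bcontfun y n)"

definition ind :: "nat set \<Rightarrow> linf" where
  "ind A = Bcontfun (indicator A)"

definition positive_map :: "(linf \<Rightarrow>\<^sub>L linf) \<Rightarrow> bool" where
  "positive_map T \<longleftrightarrow> (\<forall>x. geq x (cst 0) \<longrightarrow> geq (blinfun_apply T x) (cst 0))"

definition adjoint :: "(linf \<Rightarrow>\<^sub>L linf) \<Rightarrow> ba \<Rightarrow> ba" where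
  "adjoint T \<mu> = \<mu> o\<^sub>L T"

text \<open>Delta: finitely additive probability measures on 2^N, i.e. elements mu of ba
  whose associated set function A \<mapsto> <1_A, mu> is nonnegative with total mass 1.\<close>
definition Delta :: "ba set" where
  "Delta = {\<mu>. (\<forall>A. blinfun_apply \<mu> (ind A) \<ge> 0) \<and> blinfun_apply \<mu> (ind UNIV) = 1}"

definition eigenvector :: "(ba \<Rightarrow> ba) \<Rightarrow> ba \<Rightarrow> bool" where
  "eigenvector S \<mu> \<longleftrightarrow> \<mu> \<noteq> 0 \<and> (\<exists>l::real. S \<mu> = l *\<^sub>R \<mu>)"

definition DeltaT :: "(linf \<Rightarrow>\<^sub>L linf) \<Rightarrow> ba set" where
  "DeltaT T = {p \<in> Delta. eigenvector (adjoint T) p}"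

definition weak_star_open_in :: "ba set \<Rightarrow> ba set \<Rightarrow> bool" where
  "weak_star_open_in D U \<longleftrightarrow> U \<subseteq> D \<and>
     (\<forall>\<mu>\<in>U. \<exists>F e. finite F \<and> e > 0 \<and>
        {\<nu>\<in>D. \<forall>x\<in>F. \<bar>blinfun_apply \<nu> x - blinfun_apply \<mu> x\<bar> < e} \<subseteq> U)"

definition weak_star_lsc_on :: "ba set \<Rightarrow> (ba \<Rightarrow> ereal) \<Rightarrow> bool" where
  "weak_star_lsc_on D c \<longleftrightarrow> (\<forall>t::ereal. weak_star_open_in D {p\<in>D. c p > t})"

definition grounded_on :: "ba set \<Rightarrow> (ba \<Rightarrow> ereal) \<Rightarrow> bool" where
  "grounded_on D c \<longleftrightarrow> (INF p\<in>D. c p) = 0"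

definition nonneg_on :: "ba set \<Rightarrow> (ba \<Rightarrow> ereal) \<Rightarrow> bool" where
  "nonneg_on D c \<longleftrightarrow> (\<forall>p\<in>D. c p \<ge> 0)"

definition is_min_value :: "ba set \<Rightarrow> (ba \<Rightarrow> ereal) \<Rightarrow> linf \<Rightarrow> real \<Rightarrow> bool" where
  "is_min_value D c x r \<longleftrightarrow>
     (\<exists>p\<in>D. ereal (blinfun_apply p x) + c p = ereal r) \<and>
     (\<forall>p\<in>D. ereal r \<le> ereal (blinfun_apply p x) + c p)"

text \<open>Preference relation R x y means x \<succsim> y.\<close>
definition strict :: "(linf \<Rightarrow> linf \<Rightarrow> bool) \<Rightarrow> linf \<Rightarrow> linf \<Rightarrow> bool" where
  "strict R x y \<longleftrightarrow> R x y \<and> \<not> R y x"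

definition indiff :: "(linf \<Rightarrow> linf \<Rightarrow> bool) \<Rightarrow> linf \<Rightarrow> linf \<Rightarrow> bool" where
  "indiff R x y \<longleftrightarrow> R x y \<and> R y x"

definition represents :: "(linf \<Rightarrow> real) \<Rightarrow> (linf \<Rightarrow> linf \<Rightarrow> bool) \<Rightarrow> bool" where
  "represents I R \<longleftrightarrow> (\<forall>x y. R x y \<longleftrightarrow> I x \<ge> I y)"

definition constant_equivalent :: "(linf \<Rightarrow> real) \<Rightarrow> (linf \<Rightarrow> linf \<Rightarrow> bool) \<Rightarrow> bool" where
  "constant_equivalent I R \<longleftrightarrow> (\<forall>x. indiff R x (cst (I x))) \<and> represents I R"

definition weak_order :: "(linf \<Rightarrow> linf \<Rightarrow> bool) \<Rightarrow> bool" where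
  "weak_order R \<longleftrightarrow> (\<forall>x y. R x y \<or> R y x) \<and> (\<forall>x y z. R x y \<longrightarrow> R y z \<longrightarrow> R x z)"

definition monotonicity :: "(linf \<Rightarrow> linf \<Rightarrow> bool) \<Rightarrow> bool" where
  "monotonicity R \<longleftrightarrow> (\<forall>x y. geq x y \<longrightarrow> R x y) \<and> strict R (cst 1) (cst 0)"

definition continuity :: "(linf \<Rightarrow> linf \<Rightarrow> bool) \<Rightarrow> bool" where
  "continuity R \<longleftrightarrow> (\<forall>x y z. R x y \<longrightarrow> R y z \<longrightarrow>
     closed {\<alpha>\<in>{0..1::real}. R (\<alpha> *\<^sub>R x + (1 - \<alpha>) *\<^sub>R z) y} \<and>
     closed {\<alpha>\<in>{0..1::real}. R y (\<alpha> *\<^sub>R x + (1 - \<alpha>) *\<^sub>R z)})"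

definition ICRP :: "(linf \<Rightarrow> linf \<Rightarrow> bool) \<Rightarrow> bool" where
  "ICRP R \<longleftrightarrow> (\<forall>x y \<theta>. R x y \<longrightarrow> R (x + cst \<theta>) (y + cst \<theta>))"

definition convexity :: "(linf \<Rightarrow> linf \<Rightarrow> bool) \<Rightarrow> bool" where
  "convexity R \<longleftrightarrow> (\<forall>x y \<theta> (l::real). R x (cst \<theta>) \<longrightarrow> R y (cst \<theta>) \<longrightarrow> l \<in> {0..1} \<longrightarrow>
     R (l *\<^sub>R x + (1 - l) *\<^sub>R y) (cst \<theta>))"

definition ITIS :: "(linf \<Rightarrow>\<^sub>L linf) \<Rightarrow> (linf \<Rightarrow> linf \<Rightarrow> bool) \<Rightarrow> bool" where
  "ITIS T R \<longleftrightarrow> (\<forall>x d. R (x + d) x \<longrightarrow> R (x + blinfun_apply T d) x)"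

definition axioms_hold :: "(linf \<Rightarrow>\<^sub>L linf) \<Rightarrow> (linf \<Rightarrow> linf \<Rightarrow> bool) \<Rightarrow> bool" where
  "axioms_hold T R \<longleftrightarrow> weak_order R \<and> monotonicity R \<and> continuity R \<and> ICRP R \<and>
     convexity R \<and> ITIS T R"

end

theory Submission
  imports Defs
begin

text \<open>The constant equivalent \<open>I\<close> of a preference satisfying the axioms is a concave niveloid, so
  \<open>I x\<close> is the minimum of \<open>\<langle>x, p\<rangle> + c p\<close> over any set of probabilities \<open>p\<close> that meets every
  superdifferential of \<open>I\<close>, where \<open>c\<close> is the convex conjugate of \<open>I\<close>. Let \<open>D\<close> be the directional
  derivative of \<open>I\<close> at \<open>x\<close>. ITIS makes the cone \<open>D \<ge> 0\<close> invariant under \<open>T\<close>, and by a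
  Perron-Frobenius argument there is an \<open>r\<close> such that \<open>T - r\<close> maps nothing into the interior of
  that cone. By Hahn-Banach some linear \<open>p \<ge> D\<close> annihilates the range of \<open>T - r\<close>; it is a
  supergradient of \<open>I\<close> at \<open>x\<close> and an eigenvector of the adjoint of \<open>T\<close>. Conversely, if the adjoint
  maps \<open>p\<close> to \<open>r p\<close> with \<open>0 \<le> r \<le> 1\<close>, then \<open>\<langle>x + T d, p\<rangle>\<close> is the convex combination of
  \<open>\<langle>x, p\<rangle>\<close> and \<open>\<langle>x + d, p\<rangle>\<close> with weights \<open>1 - r\<close> and \<open>r\<close>, which gives ITIS.\<close>

section \<open>Linear minorants of sublinear functionals\<close>

text \<open>Homogeneity is asked only as an inequality: applying it to \<open>inverse t\<close>
  recovers equality, and infima inherit the one-sided form directly.\<close>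

definition sublinear :: "('a::real_vector \<Rightarrow> real) \<Rightarrow> bool" where
  "sublinear q \<longleftrightarrow> (\<forall>x y. q (x + y) \<le> q x + q y) \<and> (\<forall>t>0. \<forall>x. q (t *\<^sub>R x) \<le> t * q x)"

lemma sublinear_add: "sublinear q \<Longrightarrow> q (x + y) \<le> q x + q y"
  by (simp add: sublinear_def)

lemma sublinear_zero: "sublinear q \<Longrightarrow> q 0 = 0"
proof -
  assume "sublinear q"
  then have "q (2 *\<^sub>R 0) \<le> 2 * q 0" "q ((1/2) *\<^sub>R 0) \<le> (1/2) * q 0"
    unfolding sublinear_def by (meson zero_less_numeral half_gt_zero zero_less_one)+
  then show ?thesis by simp
qed

lemma sublinear_scale:
  assumes "sublinear q" "t \<ge> 0"
  shows "q (t *\<^sub>R x) = t * q x"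
proof (cases "t = 0")
  case False
  then have t: "t > 0" using assms by simp
  have "q (inverse t *\<^sub>R t *\<^sub>R x) \<le> inverse t * q (t *\<^sub>R x)"
    using assms t unfolding sublinear_def by (meson inverse_positive_iff_positive)
  then have "t * q x \<le> q (t *\<^sub>R x)" using t by (simp add: field_simps)
  then show ?thesis using assms t by (simp add: sublinear_def antisym)
qed (use assms sublinear_zero in auto)

lemma sublinear_minus: "sublinear q \<Longrightarrow> - q (- x) \<le> q x"
  using sublinear_add[of q x "- x"] sublinear_zero[of q] by simp

lemma sublinear_le_minus:
  assumes "sublinear f" "\<forall>x. f x \<le> q x"
  shows "- q (- x) \<le> f x"
  using sublinear_minus[OF assms(1), of x] assms(2)[rule_format, of "- x"] by linarith

text \<open>The members need not be sublinear one by one; it suffices that some index absorbs a sum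
  and some index a rescaling. This covers both chains and families of translates.\<close>

lemma sublinear_INF:
  fixes f :: "'i \<Rightarrow> 'a::real_vector \<Rightarrow> real"
  assumes ne: "J \<noteq> {}" and bdd: "\<And>x. bdd_below ((\<lambda>i. f i x) ` J)"
    and add: "\<And>i j x y. i \<in> J \<Longrightarrow> j \<in> J \<Longrightarrow> \<exists>k\<in>J. f k (x + y) \<le> f i x + f j y"
    and scale: "\<And>i t x. i \<in> J \<Longrightarrow> t > 0 \<Longrightarrow> \<exists>k\<in>J. f k (t *\<^sub>R x) \<le> t * f i x"
  shows "sublinear (\<lambda>x. INF i\<in>J. f i x)"
  unfolding sublinear_def
proof (intro conjI allI impI)
  let ?q = "\<lambda>x. INF i\<in>J. f i x"
  fix x y
  have 1: "?q (x + y) \<le> f i x + f j y" if "i \<in> J" "j \<in> J" for i j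
    using add[OF that, of x y] bdd by (meson cINF_lower order_trans)
  have "?q (x + y) - f j y \<le> ?q x" if "j \<in> J" for j
    by (rule cINF_greatest[OF ne]) (use 1[OF _ that] in \<open>simp add: algebra_simps\<close>)
  then have "?q (x + y) - ?q x \<le> ?q y"
    by (intro cINF_greatest[OF ne]) (simp add: algebra_simps)
  then show "?q (x + y) \<le> ?q x + ?q y" by simp
next
  let ?q = "\<lambda>x. INF i\<in>J. f i x"
  fix t :: real and x assume t: "t > 0"
  have "?q (t *\<^sub>R x) / t \<le> ?q x"
  proof (rule cINF_greatest[OF ne])
    fix i assume "i \<in> J"
    then have "?q (t *\<^sub>R x) \<le> t * f i x"
      using scale[OF _ t, of i x] bdd by (meson cINF_lower order_trans)
    then show "?q (t *\<^sub>R x) / t \<le> f i x" using t by (simp add: field_simps)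
  qed
  then show "?q (t *\<^sub>R x) \<le> t * ?q x" using t by (simp add: field_simps)
qed

text \<open>The infimum over \<open>t \<ge> 0\<close> of
  \<open>m (y + t *\<^sub>R a) - t * m a\<close> is sublinear and below \<open>m\<close>, hence
  equal to \<open>m\<close>. Its term at \<open>t = 1\<close> gives the missing inequality
  \<open>m x + m a \<le> m (x + a)\<close>.\<close>

lemma minimal_sublinear_linear:
  fixes m :: "'a::real_vector \<Rightarrow> real"
  assumes m: "sublinear m" and min: "\<And>f. sublinear f \<Longrightarrow> \<forall>x. f x \<le> m x \<Longrightarrow> f = m"
  shows "linear m"
proof -
  have add: "m (x + a) = m x + m a" for x a
  proof -
    let ?f = "\<lambda>t y. m (y + t *\<^sub>R a) - t * m a"
    let ?q = "\<lambda>y. INF t\<in>{0..}. ?f t y"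
    have bdd: "bdd_below ((\<lambda>t. ?f t y) ` {0..})" for y
    proof (rule bdd_belowI2)
      fix t :: real assume "t \<in> {0..}"
      then have "t * m a = m (t *\<^sub>R a)" using sublinear_scale[OF m] by simp
      also have "\<dots> \<le> m (y + t *\<^sub>R a) + m (- y)"
        using sublinear_add[OF m, of "y + t *\<^sub>R a" "- y"] by (simp add: algebra_simps)
      finally show "- m (- y) \<le> ?f t y" by simp
    qed
    have "sublinear ?q"
    proof (rule sublinear_INF)
      fix i j :: real and x y assume ij: "i \<in> {0..}" "j \<in> {0..}"
      have "?f (i + j) (x + y) \<le> ?f i x + ?f j y"
        using sublinear_add[OF m, of "x + i *\<^sub>R a" "y + j *\<^sub>R a"] by (simp add: algebra_simps)
      then show "\<exists>k\<in>{0..}. ?f k (x + y) \<le> ?f i x + ?f j y" using ij by force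
    next
      fix i t :: real and x assume it: "i \<in> {0..}" "t > 0"
      have "?f (t * i) (t *\<^sub>R x) \<le> t * ?f i x"
        using sublinear_scale[OF m, of t "x + i *\<^sub>R a"] it by (simp add: algebra_simps)
      then show "\<exists>k\<in>{0..}. ?f k (t *\<^sub>R x) \<le> t * ?f i x" using it by force
    qed (use bdd in auto)
    moreover have "\<forall>y. ?q y \<le> m y"
      using cINF_lower[OF bdd, of 0] by simp
    ultimately have "?q = m" by (rule min)
    then have "m x = ?q x" by (rule fun_cong[symmetric])
    also have "\<dots> \<le> ?f 1 x" by (rule cINF_lower[OF bdd]) simp
    finally have "m x \<le> ?f 1 x" .
    then show ?thesis using sublinear_add[OF m, of x a] by simp
  qed
  have neg: "m (- x) = - m x" for x
    using add[of x "- x"] sublinear_zero[OF m] by simp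
  have "m (t *\<^sub>R x) = t *\<^sub>R m x" for t x
  proof (cases "t \<ge> 0")
    case False
    then show ?thesis using sublinear_scale[OF m, of "- t" x] neg[of "t *\<^sub>R x"] by simp
  qed (simp add: sublinear_scale[OF m])
  then show ?thesis by (intro linearI add)
qed

text \<open>Hahn-Banach by Zorn: a chain is bounded below by its pointwise infimum, finite because
  members stay above \<open>- q (- x)\<close>, and a minimal functional is linear.\<close>

lemma sublinear_dominates_linear:
  fixes q :: "'a::real_vector \<Rightarrow> real"
  assumes q: "sublinear q"
  shows "\<exists>p. linear p \<and> (\<forall>x. p x \<le> q x)"
proof -
  let ?A = "{f. sublinear f \<and> (\<forall>x. f x \<le> q x)}"
  let ?P = "\<lambda>f g :: 'a \<Rightarrow> real. \<forall>x. g x \<le> f x"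
  have "\<exists>m\<in>?A. \<forall>f\<in>?A. ?P m f \<longrightarrow> f = m"
  proof (rule predicate_Zorn)
    show "partial_order_on ?A (relation_of ?P ?A)"
      by (rule partial_order_on_relation_ofI)
        (auto intro!: ext intro: order_trans order.antisym)
  next
    fix C assume C: "C \<in> Chains (relation_of ?P ?A)"
    then have CA: "C \<subseteq> ?A" and cmp: "\<And>f g. f \<in> C \<Longrightarrow> g \<in> C \<Longrightarrow> ?P f g \<or> ?P g f"
      by (auto simp: Chains_def relation_of_def)
    show "\<exists>u\<in>?A. \<forall>a\<in>C. ?P a u"
    proof (cases "C = {}")
      case True
      then show ?thesis using q by auto
    next
      case False
      let ?u = "\<lambda>x. INF f\<in>C. f x"
      have bdd: "bdd_below ((\<lambda>f. f x) ` C)" for x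
        by (rule bdd_belowI2[of _ "- q (- x)"]) (use CA sublinear_le_minus in blast)
      have low: "?u x \<le> f x" if "f \<in> C" for f x
        using cINF_lower[OF bdd that] .
      have "sublinear ?u"
      proof (rule sublinear_INF[OF False bdd])
        fix f g x y assume fg: "f \<in> C" "g \<in> C"
        then have sl: "f (x + y) \<le> f x + f y" "g (x + y) \<le> g x + g y"
          using CA sublinear_add by blast+
        from cmp[OF fg] show "\<exists>k\<in>C. k (x + y) \<le> f x + g y"
        proof
          assume "?P f g"
          then have "g x \<le> f x" by blast
          then show ?thesis using sl fg by (intro bexI[of _ g]) auto
        next
          assume "?P g f"
          then have "f y \<le> g y" by blast
          then show ?thesis using sl fg by (intro bexI[of _ f]) auto
        qed
      next
        fix f and t :: real and x assume "f \<in> C" "t > 0"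
        then show "\<exists>k\<in>C. k (t *\<^sub>R x) \<le> t * f x"
          using CA unfolding sublinear_def by blast
      qed
      moreover have "\<forall>x. ?u x \<le> q x"
      proof
        fix x
        obtain f where "f \<in> C" using False by blast
        then have "?u x \<le> f x" "f x \<le> q x" using low CA by blast+
        then show "?u x \<le> q x" by (rule order_trans)
      qed
      ultimately show ?thesis using low by (intro bexI[of _ ?u]) auto
    qed
  qed
  then obtain m where m: "sublinear m" "\<forall>x. m x \<le> q x"
    and min: "\<And>f. f \<in> ?A \<Longrightarrow> ?P m f \<Longrightarrow> f = m" by auto
  have "linear m"
  proof (rule minimal_sublinear_linear[OF m(1)])
    fix f assume "sublinear f" "\<forall>x. f x \<le> m x"
    then show "f = m" using m(2) by (intro min) (auto intro: order_trans)
  qed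
  then show ?thesis using m(2) by blast
qed

text \<open>The infimum of \<open>q\<close> over cosets of the range of \<open>S\<close> is finite
  by \<open>pos\<close>, and nonpositive on that range. A linear minorant is nonpositive on this
  subspace, hence zero there.\<close>

lemma sublinear_dominates_linear_vanishing:
  fixes q :: "'a::real_vector \<Rightarrow> real" and S :: "'b::real_vector \<Rightarrow> 'a"
  assumes q: "sublinear q" and S: "linear S" and pos: "\<And>d. q (S d) \<ge> 0"
  shows "\<exists>p. linear p \<and> (\<forall>x. p x \<le> q x) \<and> (\<forall>d. p (S d) = 0)"
proof -
  let ?q = "\<lambda>x. INF d. q (x + S d)"
  have bdd: "bdd_below (range (\<lambda>d. q (x + S d)))" for x
  proof (rule bdd_belowI2)
    fix d
    show "- q (- x) \<le> q (x + S d)"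
      using sublinear_add[OF q, of "x + S d" "- x"] pos[of d] by (simp add: algebra_simps)
  qed
  have low: "?q x \<le> q (x + S d)" for x d
    using cINF_lower[OF bdd, of d x] by simp
  have "sublinear ?q"
  proof (rule sublinear_INF[OF _ bdd])
    fix i j x y
    have "q (x + y + S (i + j)) \<le> q (x + S i) + q (y + S j)"
      using sublinear_add[OF q, of "x + S i" "y + S j"] by (simp add: linear_add[OF S] algebra_simps)
    then show "\<exists>k\<in>UNIV. q (x + y + S k) \<le> q (x + S i) + q (y + S j)" by blast
  next
    fix i and t :: real and x assume "t > 0"
    then have "q (t *\<^sub>R x + S (t *\<^sub>R i)) \<le> t * q (x + S i)"
      using sublinear_scale[OF q, of t "x + S i"] by (simp add: linear_scale[OF S] algebra_simps)
    then show "\<exists>k\<in>UNIV. q (t *\<^sub>R x + S k) \<le> t * q (x + S i)" by blast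
  qed auto
  then obtain p where p: "linear p" "\<And>x. p x \<le> ?q x"
    using sublinear_dominates_linear by blast
  have q0: "?q (S d) \<le> 0" for d
    using low[of "S d" "- d"] sublinear_zero[OF q] by (simp add: linear_neg[OF S])
  have "p (S d) = 0" for d
    using p(2)[of "S d"] q0[of d] p(2)[of "S (- d)"] q0[of "- d"]
    by (simp add: linear_neg[OF S] linear_neg[OF p(1)])
  moreover have "p x \<le> q x" for x
    using p(2)[of x] low[of x 0] by (simp add: linear_0[OF S])
  ultimately show ?thesis using p(1) by blast
qed

section \<open>Eigenfunctionals above a superlinear functional\<close>

text \<open>Abstracts the directional derivative of a concave niveloid. The set
  \<open>D x \<ge> 0\<close> is a convex cone with \<open>e\<close> in its interior, and
  \<open>lower\<close> makes \<open>D\<close> 1-Lipschitz.\<close>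

locale superlinear_functional =
  fixes D :: "'a::real_normed_vector \<Rightarrow> real" and e :: 'a
  assumes superadd: "D x + D y \<le> D (x + y)"
    and scale_le: "t > 0 \<Longrightarrow> t * D x \<le> D (t *\<^sub>R x)"
    and lower: "- norm x \<le> D x"
    and unit: "D e > 0"
begin

lemma scale: "t > 0 \<Longrightarrow> D (t *\<^sub>R x) = t * D x"
proof -
  assume t: "t > 0"
  then have "inverse t * D (t *\<^sub>R x) \<le> D x"
    using scale_le[of "inverse t" "t *\<^sub>R x"] by simp
  then have "D (t *\<^sub>R x) \<le> t * D x" using t by (simp add: field_simps)
  then show ?thesis using scale_le[OF t, of x] by simp
qed

lemma zero: "D 0 = 0"
  using scale[of 2 0] by simp

lemma scale': "t \<ge> 0 \<Longrightarrow> D (t *\<^sub>R x) = t * D x"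
  using scale[of t x] zero by (cases "t = 0") auto

lemma minus: "D (- x) \<le> - D x"
  using superadd[of x "- x"] zero by simp

lemma sublinear: "sublinear (\<lambda>x. - D (- x))"
  unfolding sublinear_def
proof (intro conjI allI impI)
  fix x y show "- D (- (x + y)) \<le> - D (- x) + - D (- y)"
    using superadd[of "- x" "- y"] by (simp add: algebra_simps)
next
  fix t :: real and x assume "t > 0"
  then show "- D (- (t *\<^sub>R x)) \<le> t * - D (- x)"
    using scale[of t "- x"] by simp
qed

lemma diff_le: "D x - D y \<le> norm (x - y)"
  using superadd[of x "y - x"] lower[of "y - x"] by (simp add: norm_minus_commute)

lemma continuous: "continuous_on UNIV D"
proof (rule continuous_on_iff[THEN iffD2], intro ballI allI impI)
  fix x :: 'a and \<epsilon> :: real assume "\<epsilon> > 0"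
  then show "\<exists>d>0. \<forall>y\<in>UNIV. dist y x < d \<longrightarrow> dist (D y) (D x) < \<epsilon>"
    using diff_le by (intro exI[of _ \<epsilon>]) (smt (verit) dist_norm norm_minus_commute real_norm_def)
qed

lemma eventually_positive:
  assumes "D x > 0"
  shows "\<exists>\<epsilon>>0. \<forall>t. 0 \<le> t \<longrightarrow> t < \<epsilon> \<longrightarrow> D (x + t *\<^sub>R y) > 0"
proof (intro exI[of _ "D x / (norm y + 1)"] conjI allI impI)
  show "D x / (norm y + 1) > 0" using assms by (simp add: add_nonneg_pos)
  fix t assume t: "0 \<le> t" "t < D x / (norm y + 1)"
  have "norm y + 1 > 0" by (simp add: add_nonneg_pos)
  then have "t * norm y + t < D x" using t by (simp add: field_simps)
  moreover have "D x - t * norm y \<le> D (x + t *\<^sub>R y)"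
    using superadd[of x "t *\<^sub>R y"] lower[of "t *\<^sub>R y"] t by simp
  ultimately show "D (x + t *\<^sub>R y) > 0" using t by linarith
qed

text \<open>The value \<open>r\<close> is the Perron root: the infimum of the numbers \<open>s\<close> for which \<open>s - T\<close>
  maps some element of the cone \<open>D \<ge> 0\<close> into its interior.\<close>

lemma ex_eigenvalue:
  assumes T: "linear T" and inv: "\<And>x. D x \<ge> 0 \<Longrightarrow> D (T x) \<ge> 0"
  shows "\<exists>r. \<forall>d. D (T d - r *\<^sub>R d) \<le> 0"
proof (rule ccontr)
  assume *: "\<not> ?thesis"
  \<comment> \<open>Passing to \<open>- d\<close> gives the inequality that defines
    \<open>\<Lambda>\<close>, but without control of the sign of \<open>D d\<close>. Securing that
    sign at the infimum is the remaining work.\<close>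
  have bad: "\<exists>d. D (r *\<^sub>R d - T d) > 0" for r
  proof -
    obtain d where "D (T d - r *\<^sub>R d) > 0" using * by (meson not_le)
    then show ?thesis by (intro exI[of _ "- d"]) (simp add: linear_neg[OF T])
  qed
  define \<Lambda> where "\<Lambda> = {r. \<exists>d. D d \<ge> 0 \<and> D (r *\<^sub>R d - T d) > 0}"
  have strict: "D (r *\<^sub>R d) > 0" if "D d \<ge> 0" "D (r *\<^sub>R d - T d) > 0" for r d
    using superadd[of "r *\<^sub>R d - T d" "T d"] inv[OF that(1)] that(2) by simp
  have rpos: "r > 0" if "D d \<ge> 0" "D (r *\<^sub>R d) > 0" for r d
  proof (rule ccontr)
    assume "\<not> r > 0"
    then have "D (- (r *\<^sub>R d)) \<ge> 0" using scale'[of "- r" d] that(1) by (simp add: mult_nonpos_nonneg)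
    then show False using minus[of "r *\<^sub>R d"] that(2) by simp
  qed
  \<comment> \<open>Witnesses lie strictly inside the cone: invariance gives
    \<open>D (r *\<^sub>R d) > 0\<close>, which forces \<open>r > 0\<close> and then
    \<open>D d > 0\<close>.\<close>
  have dpos: "D d > 0" if "D d \<ge> 0" "D (r *\<^sub>R d - T d) > 0" for r d
    using strict[OF that] rpos[OF that(1) strict[OF that]] scale[of r d]
    by (simp add: zero_less_mult_iff)
  have \<Lambda>pos: "r > 0" if "r \<in> \<Lambda>" for r
    using that strict rpos unfolding \<Lambda>_def by blast
  then have bddL: "bdd_below \<Lambda>" by (intro bdd_belowI[of _ 0]) (simp add: less_imp_le)
  \<comment> \<open>A multiple of \<open>e\<close> large enough to dominate \<open>T e\<close> puts
    \<open>N\<close> into \<open>\<Lambda>\<close>.\<close>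
  obtain N where N: "N > 0" "N * D e > norm (T e)"
  proof
    show "max 1 (norm (T e) / D e + 1) > 0" by simp
    have "norm (T e) / D e < max 1 (norm (T e) / D e + 1)" by simp
    then show "max 1 (norm (T e) / D e + 1) * D e > norm (T e)"
      using unit by (simp only: divide_less_eq if_True)
  qed
  have "D (N *\<^sub>R e - T e) > 0"
    using superadd[of "N *\<^sub>R e" "- T e"] lower[of "- T e"] scale[of N e] N by simp
  then have neL: "\<Lambda> \<noteq> {}" unfolding \<Lambda>_def using unit by (auto intro: less_imp_le)
  define r where "r = Inf \<Lambda>"
  \<comment> \<open>Positivity is an open condition, so a witness at \<open>r\<close> would also
    serve slightly below the infimum.\<close>
  have rnot: "r \<notin> \<Lambda>"
  proof
    assume "r \<in> \<Lambda>"
    then obtain d where d: "D d \<ge> 0" "D (r *\<^sub>R d - T d) > 0" unfolding \<Lambda>_def by blast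
    obtain \<epsilon> where "\<epsilon> > 0" and \<epsilon>: "\<And>t. 0 \<le> t \<Longrightarrow> t < \<epsilon> \<Longrightarrow> D (r *\<^sub>R d - T d + t *\<^sub>R (- d)) > 0"
      using eventually_positive[OF d(2)] by blast
    then have "D ((r - \<epsilon> / 2) *\<^sub>R d - T d) > 0"
      using \<epsilon>[of "\<epsilon> / 2"] by (simp add: algebra_simps)
    then have "r - \<epsilon> / 2 \<in> \<Lambda>" unfolding \<Lambda>_def using d(1) by blast
    then show False using cInf_lower[OF _ bddL] \<open>\<epsilon> > 0\<close> unfolding r_def by fastforce
  qed
  obtain d where d: "D (r *\<^sub>R d - T d) > 0" using bad by blast
  obtain \<epsilon> where "\<epsilon> > 0" and \<epsilon>: "\<And>t. 0 \<le> t \<Longrightarrow> t < \<epsilon> \<Longrightarrow> D (r *\<^sub>R d - T d + t *\<^sub>R d) > 0"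
    using eventually_positive[OF d] by blast
  obtain s where s: "s \<in> \<Lambda>" "s < r + \<epsilon>"
    using cInf_lessD[OF neL, of "r + \<epsilon>"] \<open>\<epsilon> > 0\<close> unfolding r_def by auto
  have "r \<le> s" unfolding r_def by (rule cInf_lower[OF s(1) bddL])
  then have sd: "D (s *\<^sub>R d - T d) > 0" using \<epsilon>[of "s - r"] s(2) by (simp add: algebra_simps)
  obtain u where u: "D u \<ge> 0" "D (s *\<^sub>R u - T u) > 0" using s(1) unfolding \<Lambda>_def by blast
  \<comment> \<open>If \<open>D d < 0\<close>, moving from \<open>d\<close> in direction
    \<open>u\<close> meets the boundary of the cone, at the latest at \<open>t1\<close>.
    Superadditivity keeps the strict inequality for \<open>s\<close> there, so \<open>dpos\<close>
    contradicts \<open>D\<close> being zero.\<close>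
  have "D d \<ge> 0"
  proof (rule ccontr)
    assume neg: "\<not> D d \<ge> 0"
    define t1 where "t1 = - D d / D u"
    have t1: "t1 \<ge> 0" using neg dpos[OF u] by (simp add: t1_def field_simps)
    have "D (d + t1 *\<^sub>R u) \<ge> 0"
      using superadd[of d "t1 *\<^sub>R u"] scale'[OF t1, of u] dpos[OF u] by (simp add: t1_def)
    moreover have "continuous_on {0..t1} (\<lambda>t. D (d + t *\<^sub>R u))"
      by (rule continuous_on_compose2[OF continuous]) (auto intro!: continuous_intros)
    ultimately obtain t where t: "0 \<le> t" "D (d + t *\<^sub>R u) = 0"
      using IVT'[of "\<lambda>t. D (d + t *\<^sub>R u)" 0 0 t1] t1 neg by auto
    have "D (s *\<^sub>R d - T d) + D (t *\<^sub>R (s *\<^sub>R u - T u)) \<le> D (s *\<^sub>R (d + t *\<^sub>R u) - T (d + t *\<^sub>R u))"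
      using superadd[of "s *\<^sub>R d - T d" "t *\<^sub>R (s *\<^sub>R u - T u)"]
      by (simp add: linear_add[OF T] linear_scale[OF T] algebra_simps)
    moreover have "D (t *\<^sub>R (s *\<^sub>R u - T u)) \<ge> 0" using scale'[OF t(1)] u(2) t(1) by simp
    ultimately have "D (s *\<^sub>R (d + t *\<^sub>R u) - T (d + t *\<^sub>R u)) > 0" using sd by linarith
    then show False using dpos[of "d + t *\<^sub>R u" s] t(2) by simp
  qed
  then show False using d rnot unfolding \<Lambda>_def by blast
qed

text \<open>Hahn-Banach is applied to \<open>\<lambda>x. - D (- x)\<close>, which the
  \<open>r\<close> of \<open>ex_eigenvalue\<close> makes nonnegative on the range of
  \<open>T - r\<close>. Using \<open>D \<le> p\<close> and \<open>lower\<close> at \<open>x\<close>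
  and \<open>- x\<close> bounds \<open>p\<close>.\<close>

lemma ex_eigenfunctional:
  assumes T: "linear T" and inv: "\<And>x. D x \<ge> 0 \<Longrightarrow> D (T x) \<ge> 0"
  obtains p r where "bounded_linear p" "\<And>x. D x \<le> p x" "\<And>x. p (T x) = r * p x"
proof -
  obtain r where r: "\<And>d. D (T d - r *\<^sub>R d) \<le> 0" using ex_eigenvalue[OF assms] by blast
  let ?S = "\<lambda>d. T d - r *\<^sub>R d"
  have S: "linear ?S" using T by (intro linear_compose_sub linear_scaleR)
  have "- D (- ?S d) \<ge> 0" for d
    using r[of "- d"] by (simp add: linear_neg[OF T])
  then obtain p where p: "linear p" "\<And>x. p x \<le> - D (- x)" "\<And>d. p (?S d) = 0"
    using sublinear_dominates_linear_vanishing[OF sublinear S] by blast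
  have ge: "D x \<le> p x" for x using p(2)[of "- x"] by (simp add: linear_neg[OF p(1)])
  have "\<bar>p x\<bar> \<le> norm x * 1" for x
    using ge[of x] lower[of x] ge[of "- x"] lower[of "- x"] by (simp add: linear_neg[OF p(1)] abs_le_iff)
  then have "bounded_linear p"
    using p(1) by (intro bounded_linear_intro[where K = 1]) (auto simp: linear_add linear_scale)
  moreover have "p (T x) = r * p x" for x
    using p(3)[of x] by (simp add: linear_diff[OF p(1)] linear_scale[OF p(1)])
  ultimately show thesis using ge that by blast
qed

end

section \<open>Concave niveloids and their superdifferentials\<close>

lemma cst_add: "cst a + cst b = cst (a + b)"
  by (rule bcontfun_eqI) simp

lemma cst_scaleR: "t *\<^sub>R cst a = cst (t * a)"
  by (rule bcontfun_eqI) simp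

lemma cst_uminus: "- cst a = cst (- a)"
  by (rule bcontfun_eqI) simp

lemma apply_ind [simp]: "apply_bcontfun (ind A) n = indicator A n"
proof -
  have "(indicator A :: nat \<Rightarrow> real) \<in> bcontfun"
    by (rule bcontfun_normI[where b = 1]) (auto simp: indicator_def)
  then show ?thesis by (simp add: ind_def Bcontfun_inverse)
qed

lemma ind_UNIV: "ind UNIV = cst 1"
  by (rule bcontfun_eqI) simp

lemma geq_add_norm: "geq (y + cst (norm (x - y))) x"
  unfolding geq_def
proof
  fix n
  have "\<bar>apply_bcontfun x n - apply_bcontfun y n\<bar> \<le> norm (x - y)"
    using norm_bounded[of "x - y" n] by simp
  then show "apply_bcontfun x n \<le> apply_bcontfun (y + cst (norm (x - y))) n" by simp
qed

locale concave_niveloid =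
  fixes I :: "linf \<Rightarrow> real"
  assumes mono: "geq x y \<Longrightarrow> I y \<le> I x"
    and translate: "I (x + cst \<theta>) = I x + \<theta>"
    and concave: "l \<in> {0..1} \<Longrightarrow> l * I x + (1 - l) * I y \<le> I (l *\<^sub>R x + (1 - l) *\<^sub>R y)"
begin

section \<open>Lipschitz bound and directional derivatives\<close>

lemma diff_le_norm: "I x - I y \<le> norm (x - y)"
  using mono[OF geq_add_norm[of y x]] translate by simp

text \<open>By concavity the quotients decrease in \<open>t\<close>, so this supremum is the usual
  one-sided limit at \<open>0\<close>.\<close>

definition dir_deriv :: "linf \<Rightarrow> linf \<Rightarrow> real" where
  "dir_deriv x d = (SUP t\<in>{0<..}. (I (x + t *\<^sub>R d) - I x) / t)"

lemma bdd_above_quotient: "bdd_above ((\<lambda>t. (I (x + t *\<^sub>R d) - I x) / t) ` {0<..})"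
proof (rule bdd_aboveI2)
  fix t :: real assume "t \<in> {0<..}"
  then show "(I (x + t *\<^sub>R d) - I x) / t \<le> norm d"
    using diff_le_norm[of "x + t *\<^sub>R d" x] by (simp add: field_simps)
qed

lemma quotient_le_dir_deriv: "t > 0 \<Longrightarrow> (I (x + t *\<^sub>R d) - I x) / t \<le> dir_deriv x d"
  unfolding dir_deriv_def by (rule cSUP_upper[OF _ bdd_above_quotient]) simp

lemma dir_deriv_least:
  assumes "\<And>t. t > 0 \<Longrightarrow> (I (x + t *\<^sub>R d) - I x) / t \<le> b"
  shows "dir_deriv x d \<le> b"
  unfolding dir_deriv_def by (rule cSUP_least) (use assms in auto)

lemma diff_le_dir_deriv: "I (x + d) - I x \<le> dir_deriv x d"
  using quotient_le_dir_deriv[of 1 x d] by simp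

text \<open>The weights of the convex combination scale both displacements to the common length
  \<open>s * t / (s + t)\<close>. Independent step sizes let the two suprema be taken
  separately.\<close>

lemma quotient_superadd:
  assumes "s > 0" "t > 0"
  shows "(I (x + s *\<^sub>R d) - I x) / s + (I (x + t *\<^sub>R d') - I x) / t \<le> dir_deriv x (d + d')"
proof -
  let ?l = "t / (s + t)" and ?r = "s * t / (s + t)"
  have st: "s + t > 0" using assms by simp
  have c: "1 - ?l = s / (s + t)" using st by (simp add: field_simps)
  have l: "?l \<in> {0..1}" using assms by simp
  have "?l *\<^sub>R (x + s *\<^sub>R d) + (1 - ?l) *\<^sub>R (x + t *\<^sub>R d')
      = (?l + (1 - ?l)) *\<^sub>R x + (?l * s) *\<^sub>R d + ((1 - ?l) * t) *\<^sub>R d'"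
    by (simp only: scaleR_add_right scaleR_add_left scaleR_scaleR ac_simps)
  also have "?l + (1 - ?l) = 1" by simp
  also have "1 *\<^sub>R x + (?l * s) *\<^sub>R d + ((1 - ?l) * t) *\<^sub>R d' = x + ?r *\<^sub>R (d + d')"
    using c by (simp add: scaleR_add_right mult.commute)
  finally have "?l * I (x + s *\<^sub>R d) + (1 - ?l) * I (x + t *\<^sub>R d') \<le> I (x + ?r *\<^sub>R (d + d'))"
    using concave[OF l, of "x + s *\<^sub>R d" "x + t *\<^sub>R d'"] by simp
  then have "?l * (I (x + s *\<^sub>R d) - I x) + (1 - ?l) * (I (x + t *\<^sub>R d') - I x)
      \<le> I (x + ?r *\<^sub>R (d + d')) - I x"
    by (simp add: algebra_simps)
  moreover have "?r > 0" using assms st by simp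
  ultimately have "(?l * (I (x + s *\<^sub>R d) - I x) + (1 - ?l) * (I (x + t *\<^sub>R d') - I x)) / ?r
      \<le> (I (x + ?r *\<^sub>R (d + d')) - I x) / ?r"
    by (intro divide_right_mono) auto
  also have "\<dots> \<le> dir_deriv x (d + d')" using \<open>?r > 0\<close> by (rule quotient_le_dir_deriv)
  also have "(?l * a + (1 - ?l) * b) / ?r = a / s + b / t" for a b
  proof -
    have "s + t \<noteq> 0" "s \<noteq> 0" "t \<noteq> 0" using assms st by auto
    then show ?thesis unfolding c by (simp add: divide_simps)
  qed
  finally show ?thesis .
qed

lemma superlinear_dir_deriv: "superlinear_functional (dir_deriv x) (cst 1)"
proof
  fix d d'
  have "(I (x + s *\<^sub>R d) - I x) / s \<le> dir_deriv x (d + d') - dir_deriv x d'" if s: "s > 0" for s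
  proof -
    have "dir_deriv x d' \<le> dir_deriv x (d + d') - (I (x + s *\<^sub>R d) - I x) / s"
    proof (rule dir_deriv_least)
      fix t :: real assume "t > 0"
      then show "(I (x + t *\<^sub>R d') - I x) / t
          \<le> dir_deriv x (d + d') - (I (x + s *\<^sub>R d) - I x) / s"
        using quotient_superadd[OF s, of t x d d'] by linarith
    qed
    then show ?thesis by simp
  qed
  then have "dir_deriv x d \<le> dir_deriv x (d + d') - dir_deriv x d'" by (rule dir_deriv_least)
  then show "dir_deriv x d + dir_deriv x d' \<le> dir_deriv x (d + d')" by simp
next
  fix t :: real and d assume t: "t > 0"
  have "dir_deriv x d \<le> dir_deriv x (t *\<^sub>R d) / t"
  proof (rule dir_deriv_least)
    fix s :: real assume s: "s > 0"
    have "(I (x + s *\<^sub>R d) - I x) / s = (I (x + (s / t) *\<^sub>R t *\<^sub>R d) - I x) / (s / t) / t"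
      using s t by simp
    also have "\<dots> \<le> dir_deriv x (t *\<^sub>R d) / t"
      using s t by (intro divide_right_mono quotient_le_dir_deriv) auto
    finally show "(I (x + s *\<^sub>R d) - I x) / s \<le> dir_deriv x (t *\<^sub>R d) / t" .
  qed
  then show "t * dir_deriv x d \<le> dir_deriv x (t *\<^sub>R d)" using t by (simp add: field_simps)
next
  fix d show "- norm d \<le> dir_deriv x d"
    using diff_le_norm[of x "x + d"] diff_le_dir_deriv[of x d] by simp
next
  show "dir_deriv x (cst 1) > 0"
    using diff_le_dir_deriv[of x "cst 1"] translate[of x 1] by simp
qed

text \<open>A derivative that is merely nonnegative may admit no step with a nonnegative increment
  of \<open>I\<close>. Adding \<open>\<epsilon>\<close> times the unit makes it strictly positive,
  so such a step exists, and the Lipschitz bound controls the perturbation as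
  \<open>\<epsilon>\<close> vanishes.\<close>

lemma dir_deriv_invariant:
  fixes T :: "linf \<Rightarrow>\<^sub>L linf"
  assumes itis: "\<And>x d. I x \<le> I (x + d) \<Longrightarrow> I x \<le> I (x + blinfun_apply T d)"
    and d: "dir_deriv x d \<ge> 0"
  shows "dir_deriv x (blinfun_apply T d) \<ge> 0"
proof -
  interpret superlinear_functional "dir_deriv x" "cst 1" by (rule superlinear_dir_deriv)
  let ?K = "norm (blinfun_apply T (cst 1)) + 1"
  have K: "?K > 0" by (simp add: add_nonneg_pos)
  have approx: "- \<epsilon> * ?K \<le> dir_deriv x (blinfun_apply T d)" if \<epsilon>: "\<epsilon> > 0" for \<epsilon>
  proof -
    let ?d = "d + \<epsilon> *\<^sub>R cst 1"
    have "dir_deriv x ?d > 0"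
      using superadd[of d "\<epsilon> *\<^sub>R cst 1"] scale[OF \<epsilon>, of "cst 1"] mult_pos_pos[OF \<epsilon> unit] d by linarith
    then obtain t where t: "t > 0" "(I (x + t *\<^sub>R ?d) - I x) / t > 0"
      using dir_deriv_least[of x ?d 0] by (meson not_le)
    then have "I x \<le> I (x + t *\<^sub>R ?d)" by (simp add: zero_less_divide_iff)
    then have "I x \<le> I (x + t *\<^sub>R blinfun_apply T ?d)"
      using itis[of x "t *\<^sub>R ?d"] by (simp only: blinfun.scaleR_right)
    then have "0 \<le> (I (x + t *\<^sub>R blinfun_apply T ?d) - I x) / t" using t(1) by simp
    also have "\<dots> \<le> dir_deriv x (blinfun_apply T ?d)" using t(1) by (rule quotient_le_dir_deriv)
    also have "\<dots> \<le> dir_deriv x (blinfun_apply T d) + norm (blinfun_apply T ?d - blinfun_apply T d)"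
      using diff_le[of "blinfun_apply T ?d" "blinfun_apply T d"] by simp
    also have "norm (blinfun_apply T ?d - blinfun_apply T d) = \<epsilon> * norm (blinfun_apply T (cst 1))"
      using \<epsilon> by (simp add: blinfun.add_right blinfun.scaleR_right)
    finally show ?thesis using \<epsilon> by (simp add: algebra_simps)
  qed
  show ?thesis
  proof (rule ccontr)
    assume "\<not> ?thesis"
    then have neg: "dir_deriv x (blinfun_apply T d) < 0" by simp
    \<comment> \<open>This makes \<open>\<epsilon> * ?K\<close> half of the supposed deficit,
      contradicting \<open>approx\<close>.\<close>
    define \<epsilon> where "\<epsilon> = - dir_deriv x (blinfun_apply T d) / 2 / ?K"
    have "\<epsilon> > 0" unfolding \<epsilon>_def using neg K by (intro divide_pos_pos) auto
    moreover have "\<epsilon> * ?K = - dir_deriv x (blinfun_apply T d) / 2"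
      unfolding \<epsilon>_def by (rule nonzero_divide_eq_eq[THEN iffD1, OF _ refl, symmetric]) (use K in simp)
    ultimately show False using approx[of \<epsilon>] neg by simp
  qed
qed

text \<open>If \<open>S\<close> is the superdifferential of \<open>I\<close> at \<open>x\<close>, then \<open>T\<^sup>*\<close> maps the cone spanned by \<open>S\<close>
  into itself, which is why \<open>S\<close> contains an eigenvector.\<close>

lemma ex_eigenvector_supergradient:
  fixes T :: "linf \<Rightarrow>\<^sub>L linf"
  assumes "\<And>x d. I x \<le> I (x + d) \<Longrightarrow> I x \<le> I (x + blinfun_apply T d)"
  shows "\<exists>p\<in>DeltaT T. \<forall>y. I y - blinfun_apply p y \<le> I x - blinfun_apply p x"
proof -
  interpret superlinear_functional "dir_deriv x" "cst 1" by (rule superlinear_dir_deriv)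
  obtain f r where f: "bounded_linear f" "\<And>d. dir_deriv x d \<le> f d"
    "\<And>d. f (blinfun_apply T d) = r * f d"
    using ex_eigenfunctional[of "blinfun_apply T"] dir_deriv_invariant[OF assms]
      bounded_linear.linear[OF blinfun.bounded_linear_right] by metis
  define p where "p = Blinfun f"
  have p: "blinfun_apply p = f" by (simp add: p_def bounded_linear_Blinfun_apply f(1))
  \<comment> \<open>At indicators this inequality gives positivity of \<open>p\<close>, and at the
    constants 1 and -1 it gives total mass one.\<close>
  have sup: "I (x + d) - I x \<le> blinfun_apply p d" for d
    using diff_le_dir_deriv[of x d] f(2)[of d] p by simp
  have "I x \<le> I (x + ind A)" for A by (rule mono) (simp add: geq_def)
  then have "blinfun_apply p (ind A) \<ge> 0" for A using sup[of "ind A"] by (meson diff_ge_0_iff_ge order_trans)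
  moreover have one: "blinfun_apply p (cst 1) = 1"
  proof -
    have "blinfun_apply p (cst 1) \<ge> 1" using sup[of "cst 1"] translate[of x 1] by simp
    moreover have "- blinfun_apply p (cst 1) \<ge> - 1"
      using sup[of "cst (- 1)"] translate[of x "- 1"]
      by (simp flip: cst_uminus add: blinfun.minus_right)
    ultimately show ?thesis by simp
  qed
  ultimately have "p \<in> Delta" by (simp add: Delta_def ind_UNIV)
  moreover have "adjoint T p = r *\<^sub>R p"
    by (rule blinfun_eqI) (simp add: adjoint_def p f(3) blinfun.scaleR_left)
  moreover have "p \<noteq> 0" using one by auto
  ultimately have "p \<in> DeltaT T" unfolding DeltaT_def eigenvector_def by blast
  moreover have "I y - blinfun_apply p y \<le> I x - blinfun_apply p x" for y
    using sup[of "y - x"] by (simp add: blinfun.diff_right)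
  ultimately show ?thesis by blast
qed

section \<open>Conjugate cost and the minimum formula\<close>

definition conj_cost :: "ba \<Rightarrow> ereal" where
  "conj_cost p = (SUP y. ereal (I y - blinfun_apply p y))"

text \<open>A supremum of weak-star continuous functions: a single \<open>y\<close> whose term
  exceeds the level determines the neighbourhood.\<close>

lemma weak_star_lsc_conj_cost: "weak_star_lsc_on S conj_cost"
  unfolding weak_star_lsc_on_def weak_star_open_in_def
proof (intro allI conjI ballI)
  fix t :: ereal and \<mu> assume "\<mu> \<in> {p \<in> S. t < conj_cost p}"
  then obtain y where y: "t < ereal (I y - blinfun_apply \<mu> y)"
    unfolding conj_cost_def by (auto simp: less_SUP_iff)
  then obtain s where s: "t \<le> ereal s" "s < I y - blinfun_apply \<mu> y"
    by (metis ereal_dense2 less_ereal.simps(1) less_imp_le)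
  let ?e = "I y - blinfun_apply \<mu> y - s"
  have "t < conj_cost \<nu>" if "\<bar>blinfun_apply \<nu> y - blinfun_apply \<mu> y\<bar> < ?e" for \<nu>
  proof -
    have "ereal s < ereal (I y - blinfun_apply \<nu> y)" using that by simp
    also have "\<dots> \<le> conj_cost \<nu>" unfolding conj_cost_def by (rule SUP_upper) simp
    finally show ?thesis using s(1) by (rule order_le_less_trans[rotated])
  qed
  then show "\<exists>F e. finite F \<and> e > 0 \<and>
      {\<nu>\<in>S. \<forall>x\<in>F. \<bar>blinfun_apply \<nu> x - blinfun_apply \<mu> x\<bar> < e} \<subseteq> {p \<in> S. t < conj_cost p}"
    using s(2) by (intro exI[of _ "{y}"] exI[of _ ?e]) auto
qed auto

lemma conj_cost_supergradient:
  assumes "\<And>y. I y - blinfun_apply p y \<le> I x - blinfun_apply p x"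
  shows "conj_cost p = ereal (I x - blinfun_apply p x)"
  unfolding conj_cost_def using assms by (intro antisym SUP_least SUP_upper) auto

text \<open>\<open>conj_cost\<close> is the least cost whose affine functionals all lie above
  \<open>I\<close>. For a supergradient at \<open>x\<close> the supremum is attained at
  \<open>x\<close>, which gives equality.\<close>

lemma is_min_value_conj_cost:
  assumes "p \<in> S" and p: "\<And>y. I y - blinfun_apply p y \<le> I x - blinfun_apply p x"
  shows "is_min_value S conj_cost x (I x)"
  unfolding is_min_value_def
proof (intro conjI ballI bexI)
  show "ereal (blinfun_apply p x) + conj_cost p = ereal (I x)"
    by (simp add: conj_cost_supergradient[OF p])
  fix q
  have "ereal (I x) = ereal (blinfun_apply q x) + ereal (I x - blinfun_apply q x)" by simp
  also have "\<dots> \<le> ereal (blinfun_apply q x) + conj_cost q"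
    unfolding conj_cost_def by (intro add_left_mono SUP_upper) simp
  finally show "ereal (I x) \<le> ereal (blinfun_apply q x) + conj_cost q" .
qed fact

lemma nonneg_conj_cost:
  assumes "I 0 = 0"
  shows "nonneg_on S conj_cost"
  unfolding nonneg_on_def
proof
  fix p
  have "ereal (I 0 - blinfun_apply p 0) \<le> conj_cost p"
    unfolding conj_cost_def by (rule SUP_upper) simp
  then show "conj_cost p \<ge> 0" using assms by (simp add: zero_ereal_def)
qed

lemma grounded_conj_cost:
  assumes 0: "I 0 = 0" and "p \<in> S" and p: "\<And>y. I y - blinfun_apply p y \<le> I 0 - blinfun_apply p 0"
  shows "grounded_on S conj_cost"
  unfolding grounded_on_def
proof (rule antisym)
  have "conj_cost p = 0" using conj_cost_supergradient[OF p] 0 by (simp add: zero_ereal_def)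
  then show "(INF p\<in>S. conj_cost p) \<le> 0" using \<open>p \<in> S\<close> by (metis INF_lower)
  show "0 \<le> (INF p\<in>S. conj_cost p)"
    using nonneg_conj_cost[OF 0, of S] unfolding nonneg_on_def by (intro INF_greatest) blast
qed

section \<open>Axioms inherited from a concave niveloid\<close>

lemma axioms_of_represents:
  assumes R: "represents I R"
  shows "weak_order R \<and> monotonicity R \<and> continuity R \<and> ICRP R \<and> convexity R"
proof (intro conjI)
  have R: "R x y \<longleftrightarrow> I y \<le> I x" for x y using R by (simp add: represents_def)
  show "weak_order R" unfolding weak_order_def R by auto
  show "monotonicity R"
    unfolding monotonicity_def strict_def R using mono translate[of 0 1] by (auto simp: add_0)
  show "ICRP R" unfolding ICRP_def R translate by simp
  have cont: "continuous_on UNIV I"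
  proof (rule continuous_on_iff[THEN iffD2], intro ballI allI impI)
    fix x :: linf and \<epsilon> :: real assume "\<epsilon> > 0"
    then show "\<exists>d>0. \<forall>y\<in>UNIV. dist y x < d \<longrightarrow> dist (I y) (I x) < \<epsilon>"
      using diff_le_norm by (intro exI[of _ \<epsilon>])
        (smt (verit) dist_norm norm_minus_commute real_norm_def)
  qed
  show "continuity R"
    unfolding continuity_def
  proof (intro allI impI)
    fix x y z
    have f: "continuous_on {0..1} (\<lambda>\<alpha>::real. I (\<alpha> *\<^sub>R x + (1 - \<alpha>) *\<^sub>R z))"
      by (rule continuous_on_compose2[OF cont]) (auto intro!: continuous_intros)
    have "closed {\<alpha>\<in>{0..1}. I y \<le> I (\<alpha> *\<^sub>R x + (1 - \<alpha>) *\<^sub>R z)}"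
      "closed {\<alpha>\<in>{0..1}. I (\<alpha> *\<^sub>R x + (1 - \<alpha>) *\<^sub>R z) \<le> I y}"
      by (intro continuous_on_closed_Collect_le f continuous_on_const closed_atLeastAtMost)+
    then show "closed {\<alpha>\<in>{0..1::real}. R (\<alpha> *\<^sub>R x + (1 - \<alpha>) *\<^sub>R z) y} \<and>
      closed {\<alpha>\<in>{0..1::real}. R y (\<alpha> *\<^sub>R x + (1 - \<alpha>) *\<^sub>R z)}" unfolding R by blast
  qed
  show "convexity R"
    unfolding convexity_def R
  proof (intro allI impI)
    fix x y \<theta> and l :: real
    assume x: "I (cst \<theta>) \<le> I x" and y: "I (cst \<theta>) \<le> I y" and l: "l \<in> {0..1}"
    have "I (cst \<theta>) = l * I (cst \<theta>) + (1 - l) * I (cst \<theta>)" by (simp add: algebra_simps)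
    also have "\<dots> \<le> l * I x + (1 - l) * I y" using x y l by (intro add_mono mult_left_mono) auto
    also have "\<dots> \<le> I (l *\<^sub>R x + (1 - l) *\<^sub>R y)" by (rule concave[OF l])
    finally show "I (cst \<theta>) \<le> I (l *\<^sub>R x + (1 - l) *\<^sub>R y)" .
  qed
qed

end

section \<open>From the axioms to the constant equivalent\<close>

text \<open>If \<open>a < b\<close> and yet \<open>R (cst a) (cst b)\<close>, ICRP moves this step
  to every level. Chaining steps of length \<open>b - a\<close> climbs past 1 and contradicts the
  strict preference of 1 over 0.\<close>

lemma cst_le_iff:
  assumes "weak_order R" "monotonicity R" "ICRP R"
  shows "R (cst a) (cst b) \<longleftrightarrow> b \<le> a"
proof
  assume "b \<le> a"
  then have "geq (cst a) (cst b)" by (simp add: geq_def)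
  then show "R (cst a) (cst b)" using assms(2) by (simp add: monotonicity_def)
next
  assume ab: "R (cst a) (cst b)"
  show "b \<le> a"
  proof (rule ccontr)
    assume "\<not> b \<le> a"
    define \<delta> where "\<delta> = b - a"
    have \<delta>: "\<delta> > 0" using \<open>\<not> b \<le> a\<close> by (simp add: \<delta>_def)
    have "R (cst a + cst (\<theta> - a)) (cst b + cst (\<theta> - a))" for \<theta>
      using assms(3) ab by (simp only: ICRP_def)
    then have step: "R (cst \<theta>) (cst (\<theta> + \<delta>))" for \<theta>
      by (simp only: cst_add) (simp add: \<delta>_def algebra_simps)
    have "R (cst 0) (cst (real n * \<delta>))" for n
    proof (induction n)
      case 0
      then show ?case using assms(1) by (auto simp: weak_order_def)
    next
      case (Suc n)
      moreover have "R (cst (real n * \<delta>)) (cst (real (Suc n) * \<delta>))"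
        using step[of "real n * \<delta>"] by (simp add: algebra_simps)
      ultimately show ?case using assms(1) unfolding weak_order_def by blast
    qed
    moreover obtain n where "1 \<le> real n * \<delta>"
      using reals_Archimedean3[OF \<delta>] by (meson less_imp_le)
    then have "R (cst (real n * \<delta>)) (cst 1)"
      using assms(2) by (simp add: monotonicity_def geq_def)
    ultimately have "R (cst 0) (cst 1)" using assms(1) unfolding weak_order_def by blast
    then show False using assms(2) by (simp add: monotonicity_def strict_def)
  qed
qed

text \<open>On the segment of constants from \<open>- norm x\<close> to \<open>norm x\<close>, the
  upper and lower sets are closed and cover \<open>{0..1}\<close>, so connectedness makes them
  meet.\<close>

lemma ex_indiff_cst:
  assumes "weak_order R" "monotonicity R" "continuity R"
  shows "\<exists>\<theta>. indiff R x (cst \<theta>)"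
proof -
  let ?M = "norm x"
  let ?f = "\<lambda>\<alpha>::real. \<alpha> *\<^sub>R cst ?M + (1 - \<alpha>) *\<^sub>R cst (- ?M)"
  let ?A = "{\<alpha>\<in>{0..1}. R (?f \<alpha>) x}" and ?B = "{\<alpha>\<in>{0..1}. R x (?f \<alpha>)}"
  have "\<bar>apply_bcontfun x n\<bar> \<le> ?M" for n using norm_bounded[of x n] by simp
  then have "geq (cst ?M) x" "geq x (cst (- ?M))"
    unfolding geq_def by (auto simp: abs_le_iff minus_le_iff)
  then have up: "R (cst ?M) x" and lo: "R x (cst (- ?M))"
    using assms(2) by (auto simp: monotonicity_def)
  then have closed: "closed ?A" "closed ?B" using assms(3) unfolding continuity_def by blast+
  have cover: "{0..1} \<subseteq> ?A \<union> ?B" using assms(1) unfolding weak_order_def by auto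
  have "1 \<in> ?A \<inter> {0..1}" "0 \<in> ?B \<inter> {0..1}" using up lo by auto
  then have "?A \<inter> {0..1} \<noteq> {}" "?B \<inter> {0..1} \<noteq> {}" by blast+
  then have "?A \<inter> ?B \<inter> {0..1} \<noteq> {}"
    using connected_closedD[OF connected_Icc _ cover closed] by blast
  then obtain \<alpha> where "R (?f \<alpha>) x" "R x (?f \<alpha>)" by blast
  moreover have "?f \<alpha> = cst (\<alpha> * ?M + (1 - \<alpha>) * - ?M)" by (simp only: cst_scaleR cst_add)
  ultimately show ?thesis unfolding indiff_def by metis
qed

lemma ex_constant_equivalent:
  assumes "weak_order R" "monotonicity R" "continuity R" "ICRP R" "convexity R"
  shows "\<exists>I. constant_equivalent I R \<and> concave_niveloid I \<and> I 0 = 0"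
proof -
  note wo = assms(1)
  have trans: "R x y \<Longrightarrow> R y z \<Longrightarrow> R x z" for x y z using wo unfolding weak_order_def by blast
  note cst_iff = cst_le_iff[OF assms(1,2,4)]
  obtain I where I: "\<And>x. indiff R x (cst (I x))"
    using ex_indiff_cst[OF assms(1-3)] by metis
  then have xI: "R x (cst (I x))" and Ix: "R (cst (I x)) x" for x by (auto simp: indiff_def)
  have rep: "R x y \<longleftrightarrow> I y \<le> I x" for x y
    using cst_iff[of "I x" "I y"] xI Ix trans by meson
  have I_cst: "I (cst \<theta>) = \<theta>" for \<theta>
    using xI[of "cst \<theta>"] Ix[of "cst \<theta>"] by (simp add: cst_iff)
  have translate: "I (x + cst \<theta>) = I x + \<theta>" for x \<theta>
  proof -
    have "R (x + cst \<theta>) (cst (I x) + cst \<theta>)" "R (cst (I x) + cst \<theta>) (x + cst \<theta>)"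
      using assms(4) xI Ix by (simp_all only: ICRP_def)
    then show ?thesis by (simp add: rep cst_add I_cst)
  qed
  have "concave_niveloid I"
  proof
    fix x y assume "geq x y"
    then show "I y \<le> I x" using assms(2) rep by (simp add: monotonicity_def)
  next
    fix l :: real and x y :: linf assume l: "l \<in> {0..1}"
    \<comment> \<open>Convexity compares with one constant level only, so \<open>y\<close> is first
      shifted to the level of \<open>x\<close>; translation invariance undoes the shift
      afterwards.\<close>
    let ?k = "I x - I y"
    have "R (y + cst ?k) (cst (I x))" by (simp add: rep I_cst translate)
    then have "R (l *\<^sub>R x + (1 - l) *\<^sub>R (y + cst ?k)) (cst (I x))"
      using assms(5) xI l unfolding convexity_def by blast
    moreover have "l *\<^sub>R x + (1 - l) *\<^sub>R (y + cst ?k)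
        = (l *\<^sub>R x + (1 - l) *\<^sub>R y) + cst ((1 - l) * ?k)"
      by (simp only: scaleR_add_right cst_scaleR add.assoc)
    ultimately have "I x \<le> I (l *\<^sub>R x + (1 - l) *\<^sub>R y) + (1 - l) * ?k"
      by (simp add: rep I_cst translate)
    then show "l * I x + (1 - l) * I y \<le> I (l *\<^sub>R x + (1 - l) *\<^sub>R y)"
      by (simp add: algebra_simps)
  qed (rule translate)
  moreover have "constant_equivalent I R"
    unfolding constant_equivalent_def represents_def using I rep by blast
  moreover have "I 0 = 0" using I_cst[of 0] by simp
  ultimately show ?thesis by blast
qed

section \<open>From the representation to the axioms\<close>

text \<open>Any \<open>x\<close> with values in \<open>[0, 1]\<close> is \<open>(1\<^sub>A + x') / 2\<close> with \<open>A = {x \<ge> 1/2}\<close> and \<open>x'\<close> of the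
  same kind, so the infimum \<open>a\<close> of a measure over such \<open>x\<close> satisfies \<open>a \<ge> a / 2\<close>.\<close>

lemma Delta_nonneg_unit_interval:
  assumes p: "p \<in> Delta" and x: "\<And>n. apply_bcontfun x n \<in> {0..1}"
  shows "blinfun_apply p x \<ge> 0"
proof -
  let ?X = "{x. \<forall>n. apply_bcontfun x n \<in> {0..1}}"
  let ?a = "INF x\<in>?X. blinfun_apply p x"
  have bdd: "bdd_below (blinfun_apply p ` ?X)"
  proof (rule bdd_belowI2)
    fix y :: linf assume "y \<in> ?X"
    then have "norm y \<le> 1" by (intro norm_bound) auto
    then have "norm p * norm y \<le> norm p" by (simp add: mult_left_le)
    then have "\<bar>blinfun_apply p y\<bar> \<le> norm p" using norm_blinfun[of p y] by simp
    then show "- norm p \<le> blinfun_apply p y" by simp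
  qed
  have xX: "x \<in> ?X" using x by simp
  have "?a / 2 \<le> ?a"
  proof (rule cINF_greatest)
    fix y :: linf assume y: "y \<in> ?X"
    let ?A = "{n. apply_bcontfun y n \<ge> 1/2}"
    let ?z = "2 *\<^sub>R y - ind ?A"
    have "?z \<in> ?X" using y by (auto simp: indicator_def)
    then have "?a \<le> blinfun_apply p ?z" by (rule cINF_lower[OF bdd])
    also have "\<dots> = 2 * blinfun_apply p y - blinfun_apply p (ind ?A)"
      by (simp add: blinfun.diff_right blinfun.scaleR_right)
    finally show "?a / 2 \<le> blinfun_apply p y" using p by (simp add: Delta_def) (smt (verit))
  qed (use xX in blast)
  then have "0 \<le> ?a" by simp
  also have "\<dots> \<le> blinfun_apply p x" by (rule cINF_lower[OF bdd xX])
  finally show ?thesis .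
qed

text \<open>Rescaling \<open>x - y\<close> into the unit interval reduces this to the positivity
  just shown; adding 1 to the norm avoids a zero divisor when \<open>x = y\<close>.\<close>

lemma Delta_mono:
  assumes p: "p \<in> Delta" and "geq x y"
  shows "blinfun_apply p y \<le> blinfun_apply p x"
proof -
  let ?N = "norm (x - y) + 1"
  let ?z = "inverse ?N *\<^sub>R (x - y)"
  have N: "?N > 0" by (simp add: add_nonneg_pos)
  have "apply_bcontfun ?z n \<in> {0..1}" for n
  proof -
    have "0 \<le> apply_bcontfun x n - apply_bcontfun y n" using assms(2) by (simp add: geq_def)
    moreover have "apply_bcontfun x n - apply_bcontfun y n \<le> ?N"
      using norm_bounded[of "x - y" n] by simp
    ultimately show ?thesis using N by (simp add: inverse_eq_divide divide_le_eq)
  qed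
  then have "0 \<le> blinfun_apply p ?z" by (rule Delta_nonneg_unit_interval[OF p])
  then show ?thesis using N by (simp add: blinfun.diff_right blinfun.scaleR_right zero_le_mult_iff)
qed

lemma Delta_cst:
  assumes "p \<in> Delta"
  shows "blinfun_apply p (cst \<theta>) = \<theta>"
  using assms blinfun.scaleR_right[of p \<theta> "cst 1"] by (simp add: Delta_def ind_UNIV cst_scaleR)

text \<open>A minimiser at \<open>x\<close> has finite cost because the minimum is real, so it gives
  an affine majorant of \<open>I\<close> touching at \<open>x\<close>. The later arguments work with
  these majorants alone.\<close>

lemma is_min_value_affine:
  assumes "\<And>x. is_min_value S c x (I x)"
  shows "\<exists>p\<in>S. \<exists>k. I x = blinfun_apply p x + k \<and> (\<forall>y. I y \<le> blinfun_apply p y + k)"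
proof -
  obtain p where p: "p \<in> S" "ereal (blinfun_apply p x) + c p = ereal (I x)"
    using assms[of x] unfolding is_min_value_def by blast
  then obtain k where k: "c p = ereal k" by (cases "c p") auto
  have "I y \<le> blinfun_apply p y + k" for y
    using assms[of y] p(1) k unfolding is_min_value_def by force
  moreover have "I x = blinfun_apply p x + k" using p(2) k by simp
  ultimately show ?thesis using p(1) by blast
qed

text \<open>Each property uses a majorant tight at a suitable point: \<open>x\<close> for
  monotonicity, the mixture for concavity. For translation, tightness at \<open>x\<close> gives one
  inequality and the opposite shift the other.\<close>

lemma concave_niveloid_min_value:
  assumes S: "S \<subseteq> Delta" and min: "\<And>x. is_min_value S c x (I x)"
  shows "concave_niveloid I"
proof
  fix x y assume xy: "geq x y"
  obtain p k where p: "p \<in> S" "I x = blinfun_apply p x + k" "\<And>y. I y \<le> blinfun_apply p y + k"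
    using is_min_value_affine[OF min, of x] by blast
  have "blinfun_apply p y \<le> blinfun_apply p x" using S p(1) xy by (intro Delta_mono) auto
  then show "I y \<le> I x" using p(2) p(3)[of y] by simp
next
  have le: "I (x + cst \<theta>) \<le> I x + \<theta>" for x \<theta>
  proof -
    obtain p k where p: "p \<in> S" "I x = blinfun_apply p x + k" "\<And>y. I y \<le> blinfun_apply p y + k"
      using is_min_value_affine[OF min, of x] by blast
    have "blinfun_apply p (cst \<theta>) = \<theta>" using S p(1) by (intro Delta_cst) auto
    then show ?thesis using p(2) p(3)[of "x + cst \<theta>"] by (simp add: blinfun.add_right)
  qed
  fix x \<theta>
  show "I (x + cst \<theta>) = I x + \<theta>"
    using le[of x \<theta>] le[of "x + cst \<theta>" "- \<theta>"] by (simp add: add.assoc cst_add)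
next
  fix l :: real and x y :: linf assume l: "l \<in> {0..1}"
  let ?z = "l *\<^sub>R x + (1 - l) *\<^sub>R y"
  obtain p k where p: "p \<in> S" "I ?z = blinfun_apply p ?z + k" "\<And>y. I y \<le> blinfun_apply p y + k"
    using is_min_value_affine[OF min, of "?z"] by blast
  have "l * I x + (1 - l) * I y
      \<le> l * (blinfun_apply p x + k) + (1 - l) * (blinfun_apply p y + k)"
    using l p(3) by (intro add_mono mult_left_mono) auto
  also have "\<dots> = I ?z"
    unfolding p(2) by (simp only: blinfun.add_right blinfun.scaleR_right) (simp add: algebra_simps)
  finally show "l * I x + (1 - l) * I y \<le> I ?z" .
qed

text \<open>The majorant is taken tight at \<open>x + T d\<close>. Its value there is a convex
  combination of its values at \<open>x\<close> and \<open>x + d\<close>, both at least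
  \<open>I x\<close>.\<close>

lemma ITIS_min_value:
  assumes T: "positive_map T" and min: "\<And>x. is_min_value (DeltaT T) c x (I x)"
    and contr: "\<And>p. p \<in> DeltaT T \<Longrightarrow> blinfun_apply (adjoint T p) (cst 1) \<le> 1"
    and xd: "I x \<le> I (x + d)"
  shows "I x \<le> I (x + blinfun_apply T d)"
proof -
  let ?y = "x + blinfun_apply T d"
  obtain p k where p: "p \<in> DeltaT T" "I ?y = blinfun_apply p ?y + k"
    "\<And>y. I y \<le> blinfun_apply p y + k"
    using is_min_value_affine[OF min, of "?y"] by blast
  obtain r where r: "adjoint T p = r *\<^sub>R p" and \<Delta>: "p \<in> Delta"
    using p(1) by (auto simp: DeltaT_def eigenvector_def)
  have pT: "blinfun_apply p (blinfun_apply T z) = r * blinfun_apply p z" for z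
    using arg_cong[OF r, of "\<lambda>q. blinfun_apply q z"] by (simp add: adjoint_def blinfun.scaleR_left)
  \<comment> \<open>As \<open>p\<close> has total mass one, the eigenvalue is the mass of
    \<open>adjoint T p\<close>. Positivity of \<open>T\<close> then gives \<open>0 \<le> r\<close>,
    and \<open>contr\<close> gives \<open>r \<le> 1\<close>.\<close>
  have r_eq: "r = blinfun_apply (adjoint T p) (cst 1)"
    using pT[of "cst 1"] Delta_cst[OF \<Delta>, of 1] by (simp add: adjoint_def)
  have "geq (blinfun_apply T (cst 1)) (cst 0)"
    using T by (simp add: positive_map_def geq_def)
  then have "0 \<le> r" using Delta_mono[OF \<Delta>] pT[of "cst 1"] Delta_cst[OF \<Delta>, of 1] by fastforce
  have "r \<le> 1" using contr[OF p(1)] r_eq by simp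
  have "I x \<le> (1 - r) * I x + r * I (x + d)"
    using mult_left_mono[OF xd \<open>0 \<le> r\<close>] by (simp add: algebra_simps)
  also have "\<dots> \<le> (1 - r) * (blinfun_apply p x + k) + r * (blinfun_apply p (x + d) + k)"
    using \<open>0 \<le> r\<close> \<open>r \<le> 1\<close> p(3) by (intro add_mono mult_left_mono) auto
  also have "\<dots> = I ?y"
    by (simp add: p(2) blinfun.add_right pT algebra_simps)
  finally show ?thesis .
qed

theorem theorem2:
  fixes T :: "linf \<Rightarrow>\<^sub>L linf"
  assumes pos: "positive_map T"
  shows "(\<forall>R::linf \<Rightarrow> linf \<Rightarrow> bool. axioms_hold T R \<longrightarrow>
           (\<exists>c::ba \<Rightarrow> ereal. nonneg_on (DeltaT T) c \<and> grounded_on (DeltaT T) c \<and>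
              weak_star_lsc_on (DeltaT T) c \<and>
              (\<exists>I. (\<forall>x. is_min_value (DeltaT T) c x (I x)) \<and> constant_equivalent I R)))
       \<and> (\<forall>R::linf \<Rightarrow> linf \<Rightarrow> bool. \<forall>c::ba \<Rightarrow> ereal. \<forall>I.
           nonneg_on (DeltaT T) c \<longrightarrow> grounded_on (DeltaT T) c \<longrightarrow>
           weak_star_lsc_on (DeltaT T) c \<longrightarrow>
           (\<forall>x. is_min_value (DeltaT T) c x (I x)) \<longrightarrow> represents I R \<longrightarrow>
           (\<forall>p\<in>DeltaT T. blinfun_apply (adjoint T p) (cst 1) \<le> 1) \<longrightarrow>
           axioms_hold T R)"
proof (intro conjI allI impI)
  fix R assume R: "axioms_hold T R"
  then obtain I where I: "constant_equivalent I R" "concave_niveloid I" "I 0 = 0"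
    using ex_constant_equivalent[of R] unfolding axioms_hold_def by blast
  interpret concave_niveloid I by fact
  have "R x y \<longleftrightarrow> I y \<le> I x" for x y
    using I(1) by (simp add: constant_equivalent_def represents_def)
  then have itis: "I x \<le> I (x + d) \<Longrightarrow> I x \<le> I (x + blinfun_apply T d)" for x d
    using R by (simp add: axioms_hold_def ITIS_def)
  \<comment> \<open>These supergradients lie in \<open>DeltaT T\<close>, so every minimum of the
    conjugate cost formula is attained in that set; the one at \<open>0\<close> gives
    groundedness.\<close>
  have "\<exists>p\<in>DeltaT T. \<forall>y. I y - blinfun_apply p y \<le> I x - blinfun_apply p x" for x
    using ex_eigenvector_supergradient[of T, OF itis] .
  then show "\<exists>c. nonneg_on (DeltaT T) c \<and> grounded_on (DeltaT T) c \<and>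
      weak_star_lsc_on (DeltaT T) c \<and>
      (\<exists>I. (\<forall>x. is_min_value (DeltaT T) c x (I x)) \<and> constant_equivalent I R)"
    using nonneg_conj_cost grounded_conj_cost weak_star_lsc_conj_cost is_min_value_conj_cost I
    by (intro exI[of _ conj_cost]) blast
next
  fix R c I
  assume min: "\<forall>x. is_min_value (DeltaT T) c x (I x)" and rep: "represents I R"
    and contr: "\<forall>p\<in>DeltaT T. blinfun_apply (adjoint T p) (cst 1) \<le> 1"
  have "concave_niveloid I"
    using min by (intro concave_niveloid_min_value[of "DeltaT T"]) (auto simp: DeltaT_def)
  moreover have "ITIS T R"
    using rep ITIS_min_value[OF pos] min contr unfolding ITIS_def represents_def by blast
  ultimately show "axioms_hold T R"
    using concave_niveloid.axioms_of_represents[OF _ rep] unfolding axioms_hold_def by blast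
qed

end
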